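(* Let $n\ge 2$ and $1\le k\le n$, and let $A(n,k)$ be the number of arithmetical structures $(\mathbf{d},\mathbf{r})$ on the path $\mathcal{P}_n$ with $\mathbf{r}(1)=k$. Then \[A(n,k)=B(n-2,n-k)=\frac{k-1}{n-1}\binom{2n-2-k}{n-2}.\]
   Context: $\mathcal{P}_n$ is the path graph with vertices $1,\dots,n$ and edges $\{i,i+1\}$, with adjacency matrix $A$. An arithmetical structure on $\mathcal{P}_n$ is a pair $(\mathbf{d},\mathbf{r})$ of positive integer vectors in $\mathbb{Z}^n$ with $\mathbf{r}$ primitive (gcd of entries $1$) and $(\operatorname{diag}(\mathbf{d})-A)\mathbf{r}=\mathbf{0}$. $\mathbf{r}(1)=\#\{i: r_i=1\}$. For nonnegative integers $k,\ell$, the ballot number $B(k,\ell)$ is the number of lattice paths from $(0,0)$ to $(k,\ell)$ using unit east and north steps that never go above the line $y=x$ (so $B(k,\ell)=0$ if $\ell>k$). *)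

theory Defs
  imports Complex_Main "Jordan_Normal_Form.Matrix"
begin

definition path_edges :: "nat \<Rightarrow> nat set set" where
  "path_edges n = {{i, i + 1} | i. 1 \<le> i \<and> i < n}"

(* The vertices are 1, ..., n, whereas matrix and vector indices run over 0, ..., n - 1:
   index i stands for the vertex i + 1. *)
definition path_adj :: "nat \<Rightarrow> int mat" where
  "path_adj n = mat n n (\<lambda>(i, j). if {i + 1, j + 1} \<in> path_edges n then 1 else 0)"

definition arithmetical_structure :: "int mat \<Rightarrow> nat \<Rightarrow> int vec \<Rightarrow> int vec \<Rightarrow> bool" where
  "arithmetical_structure A n d r \<longleftrightarrow>
     d \<in> carrier_vec n \<and> r \<in> carrier_vec n \<and>
     (\<forall>i<n. 0 < d $ i) \<and> (\<forall>i<n. 0 < r $ i) \<and>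
     Gcd (set\<^sub>v r) = 1 \<and>
     (mat_diag n (\<lambda>i. d $ i) - A) *\<^sub>v r = 0\<^sub>v n"

definition num_ones :: "int vec \<Rightarrow> nat" where
  "num_ones r = card {i. i < dim_vec r \<and> r $ i = 1}"

definition path_structures :: "nat \<Rightarrow> nat \<Rightarrow> (int vec \<times> int vec) set" where
  "path_structures n k =
     {(d, r). arithmetical_structure (path_adj n) n d r \<and> num_ones r = k}"

datatype step = East | North

(* A lattice path starting at (0, 0) is the list of its steps, so after i steps it is at
   the point (number of East steps, number of North steps) of its prefix of length i. *)
definition path_point :: "step list \<Rightarrow> nat \<times> nat" where
  "path_point w = (count_list w East, count_list w North)"

definition ballot_paths :: "nat \<Rightarrow> nat \<Rightarrow> step list set" where
  "ballot_paths k l =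
     {w. path_point w = (k, l) \<and>
         (\<forall>i\<le>length w. snd (path_point (take i w)) \<le> fst (path_point (take i w)))}"

definition ballot :: "nat \<Rightarrow> nat \<Rightarrow> nat" where
  "ballot k l = card (ballot_paths k l)"

lemma finite_ballot_paths: "finite (ballot_paths k l)"
proof -
  have len: "length w = count_list w East + count_list w North" for w
  proof (induction w)
    case (Cons s w)
    then show ?case by (cases s) auto
  qed simp
  have "finite (UNIV :: step set)"
    by (rule finite_subset[of _ "{East, North}"]) (auto intro: step.exhaust)
  then have "finite {w :: step list. set w \<subseteq> UNIV \<and> length w = k + l}"
    by (rule finite_lists_length_eq)
  then show ?thesis
    by (rule rev_finite_subset) (auto simp: ballot_paths_def path_point_def len)
qed

end

theory Submission
  imports Defs
begin

text \<open>
  An arithmetical structure on the path is determined by its vector \<open>r\<close>, a positive sequence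
  starting and ending with \<open>1\<close> in which every interior entry divides the sum of its neighbours.
  An interior maximum exceeding \<open>1\<close> must equal the sum of its neighbours, so every sequence other
  than \<open>1, \<dots>, 1\<close> has an entry (a peak) that can be deleted without changing the number of ones;
  conversely the sum of two adjacent entries can always be inserted between them. Deleting the
  leftmost peak is canonical: inserting at a gap creates a new leftmost peak exactly when no peak
  lies to the left of the two entries around the gap. This gives a Pascal-type recursion for the
  number of sequences whose leftmost peak is not before a given position, which is solved by a
  difference of binomial coefficients, as are the ballot numbers.
\<close>

section \<open>Ballot numbers: recursion and closed form\<close>

definition ballot_word :: "step list \<Rightarrow> bool" where
  "ballot_word w \<longleftrightarrow> (\<forall>i\<le>length w. count_list (take i w) North \<le> count_list (take i w) East)"

lemma ballot_paths_eq:
  "ballot_paths k l = {w. count_list w East = k \<and> count_list w North = l \<and> ballot_word w}"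
  by (auto simp: ballot_paths_def path_point_def ballot_word_def)

lemma ballot_word_Nil [simp]: "ballot_word []"
  by (simp add: ballot_word_def)

lemma ballot_word_snoc:
  "ballot_word (w @ [s]) \<longleftrightarrow>
     ballot_word w \<and> count_list (w @ [s]) North \<le> count_list (w @ [s]) East"
  unfolding ballot_word_def by (auto simp: le_Suc_eq all_conj_distrib)

lemma ballot_word_count: "ballot_word w \<Longrightarrow> count_list w North \<le> count_list w East"
  unfolding ballot_word_def by (metis order_refl take_all_iff)

lemma ballot_eq_0: "k < l \<Longrightarrow> ballot k l = 0"
proof -
  assume "k < l"
  then have "ballot_paths k l = {}" using ballot_word_count by (fastforce simp: ballot_paths_eq)
  then show ?thesis by (simp add: ballot_def)
qed

text \<open>Paths are sorted by their last step. Appending a step adds only the prefix condition at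
  the new endpoint, and \<open>l \<le> k\<close> grants it, so every shorter admissible path
  extends. The guards \<open>0 < k\<close> and \<open>0 < l\<close> keep the truncated predecessor
  of 0 from producing spurious paths.\<close>

lemma ballot_paths_snoc:
  assumes "0 < k + l" "l \<le> k"
  shows "ballot_paths k l = {w @ [East] | w. 0 < k \<and> w \<in> ballot_paths (k - 1) l} \<union>
    {w @ [North] | w. 0 < l \<and> w \<in> ballot_paths k (l - 1)}" (is "_ = ?R")
proof (intro equalityI subsetI)
  fix w assume w: "w \<in> ballot_paths k l"
  with assms have "w \<noteq> []" by (auto simp: ballot_paths_eq)
  then obtain v s where "w = v @ [s]" by (metis rev_exhaust)
  with w show "w \<in> ?R" by (cases s) (auto simp: ballot_paths_eq ballot_word_snoc)
next
  fix w assume "w \<in> ?R"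
  with assms show "w \<in> ballot_paths k l"
    by (auto simp: ballot_paths_eq ballot_word_snoc)
qed

lemma ballot_0_0 [simp]: "ballot 0 0 = 1"
proof -
  have "w = []" if "count_list w East = 0" "count_list w North = 0" for w
    using that by (cases w; cases "hd w") auto
  then have "ballot_paths 0 0 = {[]}" by (auto simp: ballot_paths_eq)
  then show ?thesis by (simp add: ballot_def)
qed

lemma ballot_Suc_0: "ballot (Suc k) 0 = ballot k 0"
proof -
  have "ballot_paths (Suc k) 0 = (\<lambda>w. w @ [East]) ` ballot_paths k 0"
    using ballot_paths_snoc[of "Suc k" 0] by auto
  then show ?thesis by (simp add: ballot_def card_image inj_on_def)
qed

lemma ballot_Suc_Suc:
  assumes "l \<le> k"
  shows "ballot (Suc k) (Suc l) = ballot k (Suc l) + ballot (Suc k) l"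
proof -
  have "ballot_paths (Suc k) (Suc l) =
      (\<lambda>w. w @ [East]) ` ballot_paths k (Suc l) \<union> (\<lambda>w. w @ [North]) ` ballot_paths (Suc k) l"
    using ballot_paths_snoc[of "Suc k" "Suc l"] assms by auto
  moreover have "(\<lambda>w. w @ [East]) ` ballot_paths k (Suc l) \<inter>
      (\<lambda>w. w @ [North]) ` ballot_paths (Suc k) l = {}" by auto
  ultimately show ?thesis
    by (simp add: ballot_def card_Un_disjoint finite_ballot_paths card_image inj_on_def)
qed

text \<open>The difference is the reflection-principle count, verified here through Pascal's rule.
  The range includes the forbidden diagonal \<open>l = Suc k\<close>, where the two binomials cancel
  by symmetry: the recursion refers to that diagonal whenever the endpoint lies on
  \<open>y = x\<close>.\<close>

lemma ballot_binomial:
  "l \<le> Suc k \<Longrightarrow> int (ballot k l) = int ((k + l) choose k) - int ((k + l) choose Suc k)"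
proof (induction "k + l" arbitrary: k l rule: less_induct)
  case less
  consider "k = 0" "l = 0" | k' where "k = Suc k'" "l = 0" | "l = Suc k"
    | k' l' where "k = Suc k'" "l = Suc l'" "l' \<le> k'"
    using less.prems by (cases k; cases l) force+
  then show ?case
  proof cases
    case 2
    then show ?thesis using less.hyps[of k' 0] by (simp add: ballot_Suc_0)
  next
    case 3
    then show ?thesis using binomial_symmetric[of k "2 * k + 1"]
      by (simp add: ballot_eq_0 mult_2)
  next
    case 4
    then show ?thesis
      using less.hyps[of k' "Suc l'"] less.hyps[of "Suc k'" l'] by (simp add: ballot_Suc_Suc)
  qed simp
qed

lemma ballot_closed_form:
  fixes k l :: nat
  assumes "l \<le> Suc k"
  shows "real (ballot k l) = (real k + 1 - real l) / (real k + 1) * real ((k + l) choose k)"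
proof -
  have "real (ballot k l) = real ((k + l) choose k) - real ((k + l) choose Suc k)"
    using ballot_binomial[OF assms] by (metis of_int_diff of_int_of_nat_eq)
  \<comment> \<open>Both sides equal \<open>(k + l) * ((k + l - 1) choose k)\<close> by
    absorption.\<close>
  moreover have "Suc k * ((k + l) choose Suc k) = l * ((k + l) choose k)"
    using binomial_absorb_comp[of "k + l" k] binomial_absorption[of k "k + l"] by simp
  then have "(real k + 1) * real ((k + l) choose Suc k) = real l * real ((k + l) choose k)"
    by (metis of_nat_Suc of_nat_mult add.commute)
  ultimately have "(real k + 1) * real (ballot k l) = (real k + 1 - real l) * real ((k + l) choose k)"
    by (simp only: left_diff_distrib right_diff_distrib)
  then show ?thesis by (simp add: field_simps)
qed

section \<open>Path sequences under subdivision and smoothing\<close>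

definition path_seq :: "int list \<Rightarrow> bool" where
  "path_seq xs \<longleftrightarrow> 2 \<le> length xs \<and> (\<forall>i<length xs. 0 < xs ! i) \<and>
     xs ! 0 = 1 \<and> xs ! (length xs - 1) = 1 \<and>
     (\<forall>i. i + 2 < length xs \<longrightarrow> xs ! (i + 1) dvd xs ! i + xs ! (i + 2))"

text \<open>The index of a peak is that of its left neighbour, which is also the gap to be subdivided.\<close>

definition peak :: "int list \<Rightarrow> nat \<Rightarrow> bool" where
  "peak xs i \<longleftrightarrow> i + 2 < length xs \<and> xs ! (i + 1) = xs ! i + xs ! (i + 2)"

definition subdivide :: "nat \<Rightarrow> int list \<Rightarrow> int list" where
  "subdivide j xs = take (Suc j) xs @ (xs ! j + xs ! Suc j) # drop (Suc j) xs"

definition smooth :: "nat \<Rightarrow> int list \<Rightarrow> int list" where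
  "smooth j xs = take (Suc j) xs @ drop (j + 2) xs"

lemma length_subdivide [simp]: "Suc j < length xs \<Longrightarrow> length (subdivide j xs) = Suc (length xs)"
  by (simp add: subdivide_def)

lemma nth_subdivide:
  assumes "Suc j < length xs" "i \<le> length xs"
  shows "subdivide j xs ! i =
    (if i \<le> j then xs ! i else if i = Suc j then xs ! j + xs ! Suc j else xs ! (i - 1))"
proof -
  consider "i \<le> j" | "i = Suc j" | i' where "i = Suc (Suc j + i')"
    by (metis less_iff_Suc_add not_le not_less_eq_eq le_antisym)
  then show ?thesis by cases (use assms in \<open>auto simp: subdivide_def nth_append min_def\<close>)
qed

lemma length_smooth: "j + 2 < length xs \<Longrightarrow> length (smooth j xs) = length xs - 1"
  by (simp add: smooth_def)

lemma nth_smooth: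
  assumes "j + 2 < length xs" "i + 1 < length xs"
  shows "smooth j xs ! i = (if i \<le> j then xs ! i else xs ! Suc i)"
  using assms by (auto simp: smooth_def nth_append min_def)

lemma subdivide_smooth:
  assumes "peak xs j"
  shows "subdivide j (smooth j xs) = xs"
proof (rule nth_equalityI)
  have j: "j + 2 < length xs" and sum: "xs ! (j + 1) = xs ! j + xs ! (j + 2)"
    using assms by (auto simp: peak_def)
  show len: "length (subdivide j (smooth j xs)) = length xs"
    using j by (simp add: length_smooth)
  fix i assume "i < length (subdivide j (smooth j xs))"
  then show "subdivide j (smooth j xs) ! i = xs ! i"
    using j sum unfolding len by (cases i) (auto simp: nth_subdivide length_smooth nth_smooth)
qed

lemma smooth_subdivide: "Suc j < length xs \<Longrightarrow> smooth j (subdivide j xs) = xs"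
  by (rule nth_equalityI) (auto simp: nth_subdivide length_smooth nth_smooth)

text \<open>The inserted entry equals its neighbour sum. For an interior entry next to the gap, the
  neighbour sum grows by that entry itself, so divisibility survives and its quotient rises by one;
  all other triples are only shifted.\<close>

lemma path_seq_subdivide:
  assumes xs: "path_seq xs" and j: "Suc j < length xs"
  shows "path_seq (subdivide j xs)"
proof -
  let ?ys = "subdivide j xs"
  have pos: "0 < xs ! i" if "i < length xs" for i using xs that by (simp add: path_seq_def)
  have dvd: "xs ! (i + 1) dvd xs ! i + xs ! (i + 2)" if "i + 2 < length xs" for i
    using xs that by (simp add: path_seq_def)
  have "?ys ! (i + 1) dvd ?ys ! i + ?ys ! (i + 2)" if i: "i + 2 < length ?ys" for i
  proof -
    consider "i + 2 \<le> j" | "i + 1 = j" | "i = j" | "i = j + 1" | i' where "i = Suc i'" "j + 1 \<le> i'"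
      by (cases i) force+
    then show ?thesis
    proof cases
      case 2
      then show ?thesis using i j dvd[of i] by (simp add: nth_subdivide)
        (metis add.assoc add.left_commute dvd_add dvd_refl)
    next
      case 4
      then show ?thesis using i j dvd[of j] by (simp add: nth_subdivide)
        (metis add.assoc add.commute dvd_add dvd_refl)
    next
      case 5
      then show ?thesis using i j dvd[of i'] by (simp add: nth_subdivide)
    qed (use i j dvd[of i] in \<open>auto simp: nth_subdivide\<close>)
  qed
  moreover have "0 < ?ys ! i" if "i < length ?ys" for i
    using that j pos by (auto simp: nth_subdivide add_pos_pos)
  ultimately show ?thesis using xs j by (auto simp: path_seq_def nth_subdivide)
qed

text \<open>The reverse computation: deleting a peak lowers the neighbour sum of an adjacent
  interior entry by exactly that entry.\<close>

lemma path_seq_smooth: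
  assumes xs: "path_seq xs" and p: "peak xs j"
  shows "path_seq (smooth j xs)"
proof -
  let ?ys = "smooth j xs"
  have j: "j + 2 < length xs" and sum: "xs ! (j + 1) = xs ! j + xs ! (j + 2)"
    using p by (auto simp: peak_def)
  have dvd: "xs ! (i + 1) dvd xs ! i + xs ! (i + 2)" if "i + 2 < length xs" for i
    using xs that by (simp add: path_seq_def)
  have "?ys ! (i + 1) dvd ?ys ! i + ?ys ! (i + 2)" if i: "i + 2 < length ?ys" for i
  proof -
    consider "i + 2 \<le> j" | "i + 1 = j" | "i = j" | "j < i" by linarith
    then show ?thesis
    proof cases
      case 2
      have "xs ! j dvd xs ! i + xs ! j + xs ! (j + 2)"
        using 2 j sum dvd[of i] by (auto simp: add.assoc)
      then have "xs ! j dvd xs ! i + xs ! (j + 2)"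
        by (metis add.assoc add.left_commute dvd_add_right_iff dvd_refl)
      then show ?thesis using 2 i j by (auto simp: nth_smooth length_smooth)
    next
      case 3
      have "xs ! (j + 2) dvd xs ! j + xs ! (j + 2) + xs ! (j + 3)"
        using 3 i j sum dvd[of "j + 1"] by (auto simp: length_smooth numeral_3_eq_3)
      then have "xs ! (j + 2) dvd xs ! j + xs ! (j + 3)"
        by (metis add.assoc add.left_commute dvd_add_right_iff dvd_refl)
      then show ?thesis using 3 i j by (auto simp: nth_smooth length_smooth numeral_3_eq_3)
    next
      case 4
      then show ?thesis using i j dvd[of "i + 1"] by (auto simp: nth_smooth length_smooth)
    qed (use i j dvd[of i] in \<open>auto simp: nth_smooth length_smooth\<close>)
  qed
  moreover have "0 < ?ys ! i" if "i < length ?ys" for i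
    using that j xs by (auto simp: nth_smooth length_smooth path_seq_def)
  moreover have "?ys ! (length ?ys - 1) = 1"
    using xs j by (auto simp: path_seq_def nth_smooth length_smooth Suc_diff_Suc numeral_2_eq_2)
  ultimately show ?thesis using xs j by (auto simp: path_seq_def nth_smooth length_smooth)
qed

lemma count_list_subdivide:
  assumes "path_seq xs" "Suc j < length xs"
  shows "count_list (subdivide j xs) 1 = count_list xs 1"
proof -
  have "0 < xs ! j" "0 < xs ! Suc j" using assms by (auto simp: path_seq_def)
  \<comment> \<open>A sum of two positive integers is at least 2, so the inserted entry is never a
    one.\<close>
  then have "xs ! j + xs ! Suc j \<noteq> 1" by linarith
  then have "count_list (subdivide j xs) 1 = count_list (take (Suc j) xs @ drop (Suc j) xs) 1"
    unfolding subdivide_def count_list_append by simp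
  then show ?thesis by simp
qed

text \<open>A peak with index just below \<open>j\<close> is destroyed, since its right neighbour
  becomes larger than itself; peaks further left are untouched. Hence \<open>j\<close> becomes the
  leftmost peak exactly when the original has no peak \<open>i\<close> with
  \<open>Suc i < j\<close>, which is the condition used in \<open>late_seqs\<close>.\<close>

lemma peak_subdivide:
  assumes "path_seq xs" "Suc j < length xs"
  shows "peak (subdivide j xs) j"
    and "Suc i < j \<Longrightarrow> peak (subdivide j xs) i \<longleftrightarrow> peak xs i"
    and "Suc i = j \<Longrightarrow> \<not> peak (subdivide j xs) i"
proof -
  have "0 < xs ! i \<and> 0 < xs ! Suc j" if "Suc i = j" using assms that by (auto simp: path_seq_def)
  then show "Suc i = j \<Longrightarrow> \<not> peak (subdivide j xs) i"
    using assms by (auto simp: peak_def nth_subdivide)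
qed (use assms in \<open>auto simp: peak_def nth_subdivide\<close>)

lemma ex_peak:
  assumes xs: "path_seq xs" and x: "x \<in> set xs" "x \<noteq> 1"
  shows "\<exists>i. peak xs i"
proof -
  define M where "M = Max (set xs)"
  have M: "M \<in> set xs" and le: "\<And>y. y \<in> set xs \<Longrightarrow> y \<le> M"
    using x by (auto simp: M_def intro: Max_in)
  \<comment> \<open>The leftmost position of the maximum is chosen so that its left neighbour is
    strictly smaller.\<close>
  define i where "i = (LEAST i. i < length xs \<and> xs ! i = M)"
  have i: "i < length xs" "xs ! i = M"
    using M LeastI_ex[of "\<lambda>i. i < length xs \<and> xs ! i = M"] by (auto simp: i_def in_set_conv_nth)
  have "0 < x" using xs x by (auto simp: path_seq_def in_set_conv_nth)
  with x le[of x] have "1 < M" by linarith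
  have "i \<noteq> 0" "i \<noteq> length xs - 1"
    using xs i(2) \<open>1 < M\<close> by (metis path_seq_def less_irrefl)+
  then obtain j where j: "i = j + 1" "j + 2 < length xs"
    using i(1) that[of "i - 1"] by fastforce
  have "xs ! j \<noteq> M" using not_less_Least[of j "\<lambda>i. i < length xs \<and> xs ! i = M"] j
    by (auto simp: i_def[symmetric])
  then have "xs ! j < M" "xs ! (j + 2) \<le> M" using le[of "xs ! j"] le[of "xs ! (j + 2)"] j by auto
  moreover have "0 < xs ! j" "0 < xs ! (j + 2)" using xs j by (auto simp: path_seq_def)
  moreover have "M dvd xs ! j + xs ! (j + 2)" using xs i j by (auto simp: path_seq_def)
  then obtain c where c: "xs ! j + xs ! (j + 2) = M * c" by (auto elim: dvdE)
  \<comment> \<open>The neighbour sum is a multiple of \<open>M\<close> strictly between 0 and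
    \<open>2 * M\<close>, hence \<open>M\<close> itself.\<close>
  ultimately have "0 < M * c" "M * c < M * 2" by linarith+
  with \<open>1 < M\<close> have "c = 1" by (simp add: zero_less_mult_iff)
  with c i j show ?thesis by (auto simp: peak_def)
qed

section \<open>Counting sequences by their leftmost peak\<close>

lemma count_list_eq_length: "count_list xs x = length xs \<longleftrightarrow> (\<forall>y\<in>set xs. y = x)"
proof (induction xs)
  case (Cons a xs)
  have "count_list xs x \<noteq> Suc (length xs)" using count_le_length[of xs x] by linarith
  with Cons show ?case by auto
qed simp

text \<open>
  The bound on \<open>q\<close> matters only for the sequence of ones, which has no peak: without it the
  recursion below would fail when started at that sequence.
\<close>

definition late_seqs :: "nat \<Rightarrow> nat \<Rightarrow> nat \<Rightarrow> int list set" where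
  "late_seqs n k q = {xs. path_seq xs \<and> length xs = n \<and> count_list xs 1 = k \<and>
     q + 2 \<le> n \<and> (\<forall>i. Suc i < q \<longrightarrow> \<not> peak xs i)}"

text \<open>On the left, \<open>q\<close> is the leftmost peak, and smoothing it inverts subdivision
  at \<open>q\<close>. The parameter drops from \<open>Suc q\<close> to \<open>q\<close> because the
  smoothed sequence may have a peak of index \<open>q - 1\<close>, which subdividing at
  \<open>q\<close> destroys again.\<close>

lemma late_seqs_peak_eq_subdivide:
  "{xs \<in> late_seqs (Suc n) k (Suc q). peak xs q} = subdivide q ` late_seqs n k q"
proof (intro equalityI subsetI)
  fix xs assume "xs \<in> {xs \<in> late_seqs (Suc n) k (Suc q). peak xs q}"
  then have xs: "path_seq xs" "length xs = Suc n" "count_list xs 1 = k" "q + 3 \<le> Suc n"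
    and np: "\<And>i. i < q \<Longrightarrow> \<not> peak xs i" and p: "peak xs q"
    by (auto simp: late_seqs_def)
  let ?ys = "smooth q xs"
  have ys: "path_seq ?ys" "subdivide q ?ys = xs" using path_seq_smooth subdivide_smooth xs p by auto
  have len: "length ?ys = n" using xs by (simp add: length_smooth)
  have "count_list ?ys 1 = k" using count_list_subdivide[of ?ys q] ys len xs by simp
  moreover have "\<not> peak ?ys i" if "Suc i < q" for i
    using peak_subdivide(2)[of ?ys q i] ys len xs np[of i] that by auto
  ultimately have "?ys \<in> late_seqs n k q" using ys len xs by (simp add: late_seqs_def)
  then show "xs \<in> subdivide q ` late_seqs n k q" using ys by (metis imageI)
next
  fix xs assume "xs \<in> subdivide q ` late_seqs n k q"
  then obtain ys where ys: "ys \<in> late_seqs n k q" "xs = subdivide q ys" by auto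
  then have "path_seq ys" "Suc q < length ys" by (auto simp: late_seqs_def)
  with ys peak_subdivide[OF this] show "xs \<in> {xs \<in> late_seqs (Suc n) k (Suc q). peak xs q}"
    by (auto simp: late_seqs_def path_seq_subdivide count_list_subdivide less_Suc_eq_le le_less)
qed

lemma late_seqs_Suc:
  assumes "k \<le> n"
  shows "late_seqs (Suc n) k (Suc q) = late_seqs (Suc n) k (q + 2) \<union> subdivide q ` late_seqs n k q"
proof -
  have "xs \<in> late_seqs (Suc n) k (q + 2)"
    if xs: "xs \<in> late_seqs (Suc n) k (Suc q)" and np: "\<not> peak xs q" for xs
  proof -
    \<comment> \<open>Here \<open>k \<le> n\<close> enters: a sequence of length
      \<open>Suc n\<close> with \<open>k\<close> ones is not constant, so it has a peak.\<close>
    have "count_list xs 1 \<noteq> length xs" using xs assms by (auto simp: late_seqs_def)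
    then obtain x where "x \<in> set xs" "x \<noteq> 1" by (auto simp: count_list_eq_length)
    then obtain i where i: "peak xs i"
      using xs ex_peak[of xs x] by (auto simp: late_seqs_def)
    with xs np have "q < i" by (auto simp: late_seqs_def) (metis linorder_neqE_nat)
    \<comment> \<open>The three positions of the peak beyond \<open>q\<close> must fit into the
      list, which supplies the stronger length bound demanded for \<open>q + 2\<close>.\<close>
    with i xs np show ?thesis by (auto simp: late_seqs_def peak_def less_Suc_eq)
  qed
  moreover have "late_seqs (Suc n) k (q + 2) \<subseteq> late_seqs (Suc n) k (Suc q)"
    by (auto simp: late_seqs_def)
  ultimately show ?thesis by (subst late_seqs_peak_eq_subdivide[symmetric]) blast
qed

lemma late_seqs_0: "3 \<le> n \<Longrightarrow> late_seqs n k 0 = late_seqs n k 1"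
  by (auto simp: late_seqs_def)

lemma late_seqs_empty: "n < q + 2 \<Longrightarrow> late_seqs n k q = {}"
  by (auto simp: late_seqs_def)

lemma late_seqs_diag:
  assumes "q + 2 \<le> k"
  shows "late_seqs k k q = {replicate k 1}"
proof -
  have "xs = replicate k 1" if "xs \<in> late_seqs k k q" for xs
  proof -
    have "length xs = k" "count_list xs 1 = length xs" using that by (auto simp: late_seqs_def)
    then show ?thesis using count_list_eq_length by (metis replicate_eqI)
  qed
  moreover have "count_list (replicate k 1) (1::int) = k"
    by (induction k) auto
  then have "replicate k 1 \<in> late_seqs k k q"
    using assms by (simp add: late_seqs_def path_seq_def peak_def)
  ultimately show ?thesis by blast
qed

text \<open>Here \<open>m\<close> is the number of entries different from 1. The outer induction is
  on \<open>m\<close>, as subdivision adds one such entry; for fixed \<open>m\<close> the position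
  \<open>q\<close> is treated downwards. The bound on \<open>q\<close> keeps the subtraction in the
  binomials from truncating.\<close>

lemma late_seqs_card:
  fixes a m q :: nat
  assumes "q \<le> a + m"
  shows "finite (late_seqs (a + 2 + m) (a + 2) q) \<and>
    int (card (late_seqs (a + 2 + m) (a + 2) q)) =
      int ((a + 2 * m - q) choose m) - int ((a + 2 * m - q) choose (a + m + 1))"
  using assms
proof (induction m arbitrary: q)
  case 0
  then show ?case by (simp add: late_seqs_diag)
next
  case (Suc m)
  let ?L = "\<lambda>m q. late_seqs (a + 2 + m) (a + 2) q"
  have rec: "?L (Suc m) (Suc p) = ?L (Suc m) (p + 2) \<union> subdivide p ` ?L m p" for p
    using late_seqs_Suc[of "a + 2" "a + 2 + m" p] by simp
  have img: "finite (subdivide p ` ?L m p) \<and> card (subdivide p ` ?L m p) = card (?L m p) \<and>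
      ?L (Suc m) (p + 2) \<inter> subdivide p ` ?L m p = {}" if "p \<le> a + m" for p
  proof (intro conjI)
    show "finite (subdivide p ` ?L m p)" using Suc.IH[OF that] by simp
    have "inj_on (subdivide p) (?L m p)"
      by (rule inj_on_inverseI[of _ "smooth p"]) (auto simp: late_seqs_def smooth_subdivide)
    then show "card (subdivide p ` ?L m p) = card (?L m p)" by (rule card_image)
    \<comment> \<open>Every member of the image has a peak at \<open>p\<close>, which the parameter
      \<open>p + 2\<close> forbids.\<close>
    show "?L (Suc m) (p + 2) \<inter> subdivide p ` ?L m p = {}"
      unfolding late_seqs_peak_eq_subdivide[symmetric] by (auto simp: late_seqs_def)
  qed
  \<comment> \<open>Downward induction on \<open>p\<close> starts at \<open>a + m\<close>, where the
    first set of \<open>rec\<close> is empty for lack of room. Each step down adds the two counts by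
    Pascal's rule, once for each binomial.\<close>
  have step: "finite (?L (Suc m) (Suc p)) \<and> int (card (?L (Suc m) (Suc p))) =
      int ((a + 2 * m + 1 - p) choose Suc m) - int ((a + 2 * m + 1 - p) choose (a + m + 2))"
    if "p \<le> a + m" for p
    using that
  proof (induction rule: inc_induct)
    case base
    have "?L (Suc m) (a + m + 2) = {}" by (simp add: late_seqs_empty)
    then show ?case using rec[of "a + m"] img[of "a + m"] Suc.IH[of "a + m"] by simp
  next
    case (step p)
    have "a + 2 * m + 1 - p = Suc (a + 2 * m - p)" "a + 2 * m + 1 - Suc p = a + 2 * m - p"
      using step.hyps by auto
    then show ?case
      using rec[of p] img[of p] Suc.IH[of p] step by (simp add: card_Un_disjoint)
  qed
  show ?case
  proof (cases q)
    case 0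
    have "?L (Suc m) 0 = ?L (Suc m) (Suc 0)" using late_seqs_0[of "a + 2 + Suc m"] by simp
    \<comment> \<open>Parameters 0 and 1 define the same set. Pascal's rule shows that the formula
      at 0 exceeds that at 1 by the difference of these two binomials, which symmetry makes
      zero.\<close>
    moreover have "(a + 2 * m + 1) choose m = (a + 2 * m + 1) choose (a + m + 1)"
      using binomial_symmetric[of m "a + 2 * m + 1"] by (simp add: algebra_simps)
    ultimately show ?thesis using 0 step[of 0] by simp
  next
    case (Suc p)
    then show ?thesis using step[of p] Suc.prems by simp
  qed
qed

section \<open>From arithmetical structures to path sequences\<close>

lemma path_adj_mult:
  assumes "i < n" "d \<in> carrier_vec n" "r \<in> carrier_vec n"
  shows "((mat_diag n (\<lambda>i. d $ i) - path_adj n) *\<^sub>v r) $ i =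
    d $ i * r $ i - (if 0 < i then r $ (i - 1) else 0) - (if i + 1 < n then r $ (i + 1) else 0)"
proof -
  have edge: "{i + 1, j + 1} \<in> path_edges n \<longleftrightarrow> j = i + 1 \<or> i = j + 1" if "j < n" for j
    using that assms(1) by (auto simp: path_edges_def doubleton_eq_iff)
  have "((mat_diag n (\<lambda>i. d $ i) - path_adj n) *\<^sub>v r) $ i =
      (\<Sum>j = 0..<n. ((if i = j then d $ j else 0) - (if j = i + 1 \<or> i = j + 1 then 1 else 0)) * r $ j)"
    using assms edge by (auto simp: scalar_prod_def path_adj_def mat_diag_def intro!: sum.cong)
  \<comment> \<open>Each part now has at most one nonzero summand. The inner test
    \<open>0 < i\<close> is needed because \<open>i - 1\<close> is 0 for \<open>i = 0\<close>; for
    \<open>i = n - 1\<close> the index \<open>i + 1\<close> falls outside the range of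
    summation.\<close>
  also have "\<dots> = (\<Sum>j = 0..<n. (if j = i then d $ i * r $ i else 0) -
      (if j = i - 1 then if 0 < i then r $ (i - 1) else 0 else 0) -
      (if j = i + 1 then r $ (i + 1) else 0))"
    by (rule sum.cong) auto
  also have "\<dots> = d $ i * r $ i - (if 0 < i then r $ (i - 1) else 0) -
      (if i + 1 < n then r $ (i + 1) else 0)"
    using assms(1) by (simp add: sum_subtractf)
  finally show ?thesis .
qed

lemma arithmetical_structure_path_iff:
  "arithmetical_structure (path_adj n) n d r \<longleftrightarrow>
     d \<in> carrier_vec n \<and> r \<in> carrier_vec n \<and>
     (\<forall>i<n. 0 < d $ i) \<and> (\<forall>i<n. 0 < r $ i) \<and> Gcd (set\<^sub>v r) = 1 \<and>
     (\<forall>i<n. d $ i * r $ i =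
       (if 0 < i then r $ (i - 1) else 0) + (if i + 1 < n then r $ (i + 1) else 0))"
proof -
  have "(mat_diag n (\<lambda>i. d $ i) - path_adj n) *\<^sub>v r = 0\<^sub>v n \<longleftrightarrow>
      (\<forall>i<n. ((mat_diag n (\<lambda>i. d $ i) - path_adj n) *\<^sub>v r) $ i = 0)"
    by (auto simp: vec_eq_iff path_adj_def)
  then show ?thesis
    by (auto simp: arithmetical_structure_def path_adj_mult algebra_simps cong: conj_cong)
qed

text \<open>Serves to spread divisibility by an end entry of \<open>r\<close> along the whole path,
  each interior row of the system being such a three-term recurrence.\<close>

lemma dvd_recurrence:
  fixes f g :: "nat \<Rightarrow> int"
  assumes "c dvd f 0" "c dvd f 1" "\<And>i. i + 2 < n \<Longrightarrow> f (i + 2) = g i * f (i + 1) - f i"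
  shows "i < n \<Longrightarrow> c dvd f i"
proof (induction i rule: less_induct)
  case (less i)
  consider "i = 0" | "i = 1" | j where "i = j + 2" by (metis One_nat_def add_2_eq_Suc' not0_implies_Suc)
  then show ?case
    by cases (use assms less in auto)
qed

text \<open>The row of an end vertex makes the adjacent entry a multiple of the end entry. The
  interior rows carry this divisibility to every entry, and primitivity leaves only 1.\<close>

lemma path_structure_ends:
  assumes "arithmetical_structure (path_adj n) n d r" "2 \<le> n"
  shows "r $ 0 = 1" "r $ (n - 1) = 1"
proof -
  have pos: "0 < r $ i" if "i < n" for i
    using assms(1) that by (simp add: arithmetical_structure_path_iff)
  have eq: "d $ i * r $ i =
      (if 0 < i then r $ (i - 1) else 0) + (if i + 1 < n then r $ (i + 1) else 0)" if "i < n" for i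
    using assms(1) that by (simp add: arithmetical_structure_path_iff)
  have mid: "d $ (i + 1) * r $ (i + 1) = r $ i + r $ (i + 2)" if "i + 2 < n" for i
    using eq[of "i + 1"] that by simp
  have unit: "c = 1" if "0 < c" "\<And>i. i < n \<Longrightarrow> c dvd r $ i" for c
  proof -
    have "c dvd Gcd (set\<^sub>v r)"
      using that(2) assms(1)
      by (intro Gcd_greatest) (auto simp: arithmetical_structure_path_iff vec_set_def)
    then have "is_unit c" using assms(1) by (simp add: arithmetical_structure_path_iff)
    then show ?thesis using that(1) by simp
  qed
  show "r $ 0 = 1"
  proof (rule unit)
    have "r $ 1 = d $ 0 * r $ 0" using eq[of 0] assms(2) by simp
    then show "r $ 0 dvd r $ i" if "i < n" for i
      using dvd_recurrence[of "r $ 0" "($) r" n "\<lambda>i. d $ (i + 1)"] mid that by simp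
  qed (use pos assms in auto)
  show "r $ (n - 1) = 1"
  proof (rule unit)
    \<comment> \<open>The other end is handled by reading \<open>r\<close> backwards, which
      satisfies a recurrence of the same shape.\<close>
    let ?f = "\<lambda>i. r $ (n - 1 - i)"
    have "?f 1 = d $ (n - 1) * ?f 0" using eq[of "n - 1"] assms(2) by simp
    moreover have "?f (i + 2) = d $ (n - 2 - i) * ?f (i + 1) - ?f i" if "i + 2 < n" for i
    proof -
      \<comment> \<open>\<open>j\<close> is the lowest of the three vertex indices involved;
        expressing the others through it removes the truncated subtractions.\<close>
      define j where "j = n - 3 - i"
      have "n - 1 - i = j + 2" "n - 1 - (i + 1) = j + 1" "n - 2 - i = j + 1" "n - 1 - (i + 2) = j"
        "j + 2 < n"
        using that by (auto simp: j_def)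
      then show ?thesis using mid[of j] by simp
    qed
    ultimately have f: "?f 0 dvd ?f i" if "i < n" for i
      using dvd_recurrence[of "?f 0" ?f n "\<lambda>i. d $ (n - 2 - i)"] that by simp
    show "r $ (n - 1) dvd r $ i" if "i < n" for i
      using f[of "n - 1 - i"] that by simp
  qed (use pos assms in auto)
qed

lemma count_list_conv_card: "count_list xs x = card {i. i < length xs \<and> xs ! i = x}"
  unfolding count_list_eq_length_filter length_filter_conv_card by (simp add: eq_commute[of x])

lemma num_ones_list: "num_ones (vec_of_list xs) = count_list xs 1"
  by (simp add: num_ones_def count_list_conv_card vec_of_list_index)

text \<open>Since \<open>r\<close> is positive, each row determines its entry of \<open>d\<close> as
  the neighbour sum divided by that of \<open>r\<close>. The parameter 0 in \<open>late_seqs\<close>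
  imposes no condition on peaks.\<close>

lemma path_structures_bij:
  assumes n: "2 \<le> n"
  shows "bij_betw (\<lambda>(d, r). list_of_vec r) (path_structures n k) (late_seqs n k 0)"
proof (rule bij_betw_imageI)
  show "inj_on (\<lambda>(d, r). list_of_vec r) (path_structures n k)"
  proof (rule inj_onI, clarsimp)
    fix d r d' r'
    assume S: "(d, r) \<in> path_structures n k" "(d', r') \<in> path_structures n k"
      and "list_of_vec r = list_of_vec r'"
    then have r: "r = r'" by (metis vec_list)
    have "d $ i = d' $ i" if "i < n" for i
    proof -
      have "d $ i * r $ i = d' $ i * r $ i" "0 < r $ i"
        using S that unfolding r by (simp_all add: path_structures_def arithmetical_structure_path_iff)
      then show ?thesis by simp
    qed
    moreover have "d \<in> carrier_vec n" "d' \<in> carrier_vec n"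
      using S by (auto simp: path_structures_def arithmetical_structure_path_iff)
    ultimately show "d = d' \<and> r = r'" using r by auto
  qed
  show "(\<lambda>(d, r). list_of_vec r) ` path_structures n k = late_seqs n k 0"
  proof (intro equalityI subsetI)
    fix xs assume "xs \<in> (\<lambda>(d, r). list_of_vec r) ` path_structures n k"
    then obtain d r where S: "arithmetical_structure (path_adj n) n d r" "num_ones r = k"
      and xs: "xs = list_of_vec r"
      by (auto simp: path_structures_def)
    have r: "r = vec_of_list xs" by (simp add: xs vec_list)
    have len: "length xs = n" using S xs by (simp add: arithmetical_structure_path_iff)
    have nth: "r $ i = xs ! i" for i by (simp add: r vec_of_list_index)
    have "xs ! (i + 1) dvd xs ! i + xs ! (i + 2)" if "i + 2 < n" for i
    proof -
      have "\<forall>i<n. d $ i * r $ i =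
          (if 0 < i then r $ (i - 1) else 0) + (if i + 1 < n then r $ (i + 1) else 0)"
        using S(1) by (simp add: arithmetical_structure_path_iff)
      from this[rule_format, of "i + 1"] that
      have "xs ! i + xs ! (i + 2) = d $ (i + 1) * xs ! (i + 1)" by (simp add: nth)
      then show ?thesis by simp
    qed
    then have "path_seq xs"
      using S(1) path_structure_ends[OF S(1) n] n
      by (simp add: path_seq_def len arithmetical_structure_path_iff nth)
    then show "xs \<in> late_seqs n k 0"
      using S(2) n len by (simp add: late_seqs_def r num_ones_list)
  next
    fix xs assume xs: "xs \<in> late_seqs n k 0"
    define r where "r = vec_of_list xs"
    define s where "s i = (if 0 < i then r $ (i - 1) else 0) + (if i + 1 < n then r $ (i + 1) else 0)"
      for i
    define d where "d = vec n (\<lambda>i. s i div r $ i)"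
    have len: "length xs = n" and P: "path_seq xs" using xs by (auto simp: late_seqs_def)
    have r: "r \<in> carrier_vec n" and nth: "\<And>i. r $ i = xs ! i"
      by (auto simp: r_def len vec_of_list_index carrier_vecI)
    have pos: "0 < r $ i" if "i < n" for i using P that by (simp add: path_seq_def len nth)
    \<comment> \<open>With \<open>n \<ge> 2\<close> every vertex has at least one neighbour.\<close>
    have s_pos: "0 < s i" if "i < n" for i
      using that n pos[of "i - 1"] pos[of "i + 1"] by (auto simp: s_def intro!: add_pos_pos)
    have s_dvd: "r $ i dvd s i" if i: "i < n" for i
    proof -
      consider "i = 0" | "i = n - 1" | j where "i = j + 1" "j + 2 < n"
      proof (cases "i = 0 \<or> i = n - 1")
        case False
        then have "i = (i - 1) + 1" "(i - 1) + 2 < n" using i by linarith+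
        then show thesis by (rule that)
      qed (use that in blast)
      \<comment> \<open>The end entries are 1 and divide anything; in the interior this is the
        divisibility required by \<open>path_seq\<close>.\<close>
      then show ?thesis
        by cases (use P in \<open>auto simp: path_seq_def len nth s_def\<close>)
    qed
    have ds: "d $ i * r $ i = s i" if "i < n" for i using s_dvd[OF that] that by (simp add: d_def)
    then have "0 < d $ i" if "i < n" for i
      using s_pos[OF that] pos[OF that] that by (metis zero_less_mult_pos2)
    moreover have "1 \<in> set\<^sub>v r"
      using P n r by (auto simp: path_seq_def nth[symmetric] vec_set_def intro!: rev_image_eqI[of 0])
    then have "Gcd (set\<^sub>v r) = 1" by (metis Gcd_1)
    ultimately have "arithmetical_structure (path_adj n) n d r"
      using r pos ds by (auto simp: arithmetical_structure_path_iff s_def d_def)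
    moreover have "num_ones r = k" using xs by (simp add: r_def num_ones_list late_seqs_def)
    ultimately have "(d, r) \<in> path_structures n k" by (simp add: path_structures_def)
    then show "xs \<in> (\<lambda>(d, r). list_of_vec r) ` path_structures n k"
      by (force simp: r_def list_vec)
  qed
qed

section \<open>Matching the two counts\<close>

lemma two_le_count_path_seq:
  assumes "path_seq xs"
  shows "2 \<le> count_list xs 1"
proof -
  have "{0, length xs - 1} \<subseteq> {i. i < length xs \<and> xs ! i = 1}"
    using assms by (auto simp: path_seq_def)
  then have "card {0, length xs - 1} \<le> count_list xs 1"
    unfolding count_list_conv_card by (rule card_mono[rotated]) auto
  then show ?thesis using assms by (auto simp: path_seq_def)
qed

theorem theorem2p9:
  fixes n k :: nat
  assumes "n \<ge> 2" and "1 \<le> k" and "k \<le> n"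
  shows "finite (path_structures n k) \<and>
         card (path_structures n k) = ballot (n - 2) (n - k) \<and>
         real (ballot (n - 2) (n - k)) =
           (real k - 1) / (real n - 1) * real ((2 * n - 2 - k) choose (n - 2))"
proof -
  have "finite (late_seqs n k 0) \<and> card (late_seqs n k 0) = ballot (n - 2) (n - k)"
  proof (cases "k = 1")
    case True
    \<comment> \<open>The two ends are distinct ones, so a single one is impossible; the ballot
      number vanishes as well, its endpoint \<open>(n - 2, n - 1)\<close> lying above the
      diagonal.\<close>
    have "late_seqs n 1 0 = {}" using two_le_count_path_seq by (force simp: late_seqs_def)
    then show ?thesis using True assms by (simp add: ballot_eq_0)
  next
    case False
    \<comment> \<open>\<open>a\<close> counts the ones besides the two ends, \<open>m\<close> the
      entries exceeding 1.\<close>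
    define a m where "a = k - 2" and "m = n - k"
    have *: "k = a + 2" "n = a + 2 + m" using False assms by (auto simp: a_def m_def)
    \<comment> \<open>\<open>late_seqs_card\<close> and \<open>ballot_binomial\<close> express the
      first binomial through complementary lower indices.\<close>
    have "(a + 2 * m) choose m = (a + 2 * m) choose (a + m)"
      using binomial_symmetric[of m "a + 2 * m"] by (simp add: algebra_simps)
    moreover have "int (ballot (a + m) m) =
        int ((a + 2 * m) choose (a + m)) - int ((a + 2 * m) choose (a + m + 1))"
      using ballot_binomial[of m "a + m"] by (simp add: mult_2 add.assoc)
    ultimately show ?thesis using late_seqs_card[of 0 a m] by (simp add: *)
  qed
  moreover have "real (ballot (n - 2) (n - k)) =
      (real k - 1) / (real n - 1) * real ((2 * n - 2 - k) choose (n - 2))"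
  proof -
    \<comment> \<open>The closed form applies for \<open>k = 1\<close> too, where
      \<open>n - k\<close> is exactly \<open>Suc (n - 2)\<close>.\<close>
    have "n - 2 + (n - k) = 2 * n - 2 - k" using assms by linarith
    then show ?thesis
      using ballot_closed_form[of "n - k" "n - 2"] assms by (simp add: of_nat_diff)
  qed
  ultimately show ?thesis
    using path_structures_bij[OF assms(1), of k] by (metis bij_betw_finite bij_betw_same_card)
qed

end
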